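(* Let $d\ge 1$, $L>0$, let $f:\mathbb{R}^d\to\mathbb{R}$ be convex and $L$-smooth with at least one minimizer $x_\ast$, let $\delta\in(0,1)$, let $h\in\left[0,\frac{2}{1+\delta}\right]$ and let $N\ge 1$ be an integer. Let $x_0\in\mathbb{R}^d$ and let $x_1,\dots,x_N$ be any iterates generated from $x_0$ by $N$ steps of relatively inexact gradient descent with constant normalized stepsize $h$ and relative inexactness $\delta$. Then $$\frac{1}{L}\min_{k\in\{1,\dots,N\}}\|\nabla f(x_k)\|^2\le \tilde C_N(h,\delta)\,\bigl(f(x_0)-f(x_\ast)\bigr),$$ where $\tilde C_N(h,\delta)$ is given by the following function, continuous in $h$: $$\tilde C_N(h,\delta)=\begin{cases}\dfrac{1}{Nh(1-\delta)+\frac12}, & h\in\left[0,\frac{3}{2(1+\delta)}\right),\\[2mm] \dfrac{2\tilde\lambda}{N\left(h\tilde\lambda^2+2(h-1)\tilde\lambda+h-1\right)+\tilde\lambda}, & h\in\left[\frac{3}{2(1+\delta)},\frac{3\delta+2-\sqrt{4-3\delta^2}}{2\delta(\delta+1)}\right],\\[2mm] \dfrac{2}{N(1-h(1+\delta))^{-2}-(N-1)}, & h\in\left(\frac{3\delta+2-\sqrt{4-3\delta^2}}{2\delta(\delta+1)},\frac{2}{1+\delta}\right],\end{cases}$$ and $\tilde\lambda=\tilde\lambda(h,\delta)$ is the largest real root of the cubic equation in $\lambda$ $$\left[(\delta^2-1)h^2+2h\right]\lambda^3+\left[2(\delta^2-1)h^2+5h-4\right]\lambda^2+\left[(\delta^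2-1)h^2+4h-4\right]\lambda+\left[h-1\right]=0.$$
   Context: $\|\cdot\|$ is the Euclidean norm. A differentiable function $f:\mathbb{R}^d\to\mathbb{R}$ is $L$-smooth if $\|\nabla f(x)-\nabla f(y)\|\le L\|x-y\|$ for all $x,y$. Relatively inexact gradient descent with constant normalized stepsize $h$ and relative inexactness $\delta$: starting from $x_0$, for $k=0,1,2,\dots$, an arbitrary vector $d_k\in\mathbb{R}^d$ satisfying $\|d_k-\nabla f(x_k)\|\le\delta\|\nabla f(x_k)\|$ is used, and $x_{k+1}=x_k-\frac{h}{L}d_k$. *)

theory Defs
  imports "HOL-Analysis.Analysis"
begin

definition gradient :: "('a::real_inner \<Rightarrow> real) \<Rightarrow> 'a \<Rightarrow> 'a" where
  "gradient f x = (THE v. GDERIV f x :> v)"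

lemma gradient_eqI: "GDERIV f x :> v \<Longrightarrow> gradient f x = v"
  unfolding gradient_def
proof (rule the_equality)
  fix w assume "GDERIV f x :> v" "GDERIV f x :> w"
  then have "(\<lambda>h. inner h w) = (\<lambda>h. inner h v)"
    unfolding gderiv_def by (rule has_derivative_unique[rotated])
  then have "inner (w - v) (w - v) = 0"
    by (metis diff_self inner_diff_right)
  then show "w = v" by simp
qed

lemma GDERIV_gradient:
  fixes f :: "'a::euclidean_space \<Rightarrow> real"
  assumes "f differentiable (at x)"
  shows "GDERIV f x :> gradient f x"
proof -
  from assms obtain D where D: "(f has_derivative D) (at x)"
    unfolding differentiable_def by blast
  then interpret bounded_linear D by (rule has_derivative_bounded_linear)
  let ?v = "\<Sum>b\<in>Basis. D b *\<^sub>R b"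
  have "D h = inner h ?v" for h
  proof -
    have "D h = D (\<Sum>b\<in>Basis. inner h b *\<^sub>R b)"
      by (simp add: euclidean_representation)
    also have "\<dots> = inner h ?v"
      by (simp add: sum scaleR inner_sum_right mult.commute)
    finally show ?thesis .
  qed
  then have "D = (\<lambda>h. inner h ?v)" by blast
  with D have "GDERIV f x :> ?v" by (simp add: gderiv_def)
  then show ?thesis using gradient_eqI by metis
qed

definition smooth_with :: "real \<Rightarrow> ('a::real_inner \<Rightarrow> real) \<Rightarrow> bool" where
  "smooth_with L f \<longleftrightarrow>
     (\<forall>x. f differentiable (at x)) \<and>
     (\<forall>x y. norm (gradient f x - gradient f y) \<le> L * norm (x - y))"

text \<open>Only the entries \<open>x 0, \<dots>, x N\<close> are constrained. The inexact gradients are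
  chosen freely, subject to the relative error bound.\<close>

definition inexact_gd_iterates ::
  "('a::real_inner \<Rightarrow> real) \<Rightarrow> real \<Rightarrow> real \<Rightarrow> real \<Rightarrow> nat \<Rightarrow> (nat \<Rightarrow> 'a) \<Rightarrow> bool" where
  "inexact_gd_iterates f L h \<delta> N x \<longleftrightarrow>
     (\<exists>d. \<forall>k<N. norm (d k - gradient f (x k)) \<le> \<delta> * norm (gradient f (x k)) \<and>
                x (Suc k) = x k - (h / L) *\<^sub>R d k)"

definition rate_cubic :: "real \<Rightarrow> real \<Rightarrow> real \<Rightarrow> real" where
  "rate_cubic h \<delta> l =
     ((\<delta>\<^sup>2 - 1) * h\<^sup>2 + 2 * h) * l ^ 3
     + (2 * (\<delta>\<^sup>2 - 1) * h\<^sup>2 + 5 * h - 4) * l\<^sup>2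
     + ((\<delta>\<^sup>2 - 1) * h\<^sup>2 + 4 * h - 4) * l
     + (h - 1)"

definition rate_lambda :: "real \<Rightarrow> real \<Rightarrow> real" where
  "rate_lambda h \<delta> = (GREATEST l. rate_cubic h \<delta> l = 0)"

lemma rate_lambda_greatest_root:
  assumes "0 < \<delta>" "\<delta> < 1" "0 < h" "h \<le> 2 / (1 + \<delta>)"
  shows "rate_cubic h \<delta> (rate_lambda h \<delta>) = 0"
    and "rate_cubic h \<delta> l = 0 \<Longrightarrow> l \<le> rate_lambda h \<delta>"
proof -
  define a b c d where "a = (\<delta>\<^sup>2 - 1) * h\<^sup>2 + 2 * h" and "b = 2 * (\<delta>\<^sup>2 - 1) * h\<^sup>2 + 5 * h - 4"
    and "c = (\<delta>\<^sup>2 - 1) * h\<^sup>2 + 4 * h - 4" and "d = h - 1"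
  note abcd = this
  have "h * (1 + \<delta>) \<le> 2" using assms by (simp add: field_simps)
  then have "h * (1 + \<delta>) * (1 - \<delta>) \<le> 2 * (1 - \<delta>)"
    using assms by (intro mult_right_mono) auto
  also have "\<dots> < 2" using assms by simp
  finally have "0 < 2 - h * (1 + \<delta>) * (1 - \<delta>)" by (simp only: diff_gt_0_iff_gt)
  with assms have "0 < h * (2 - h * (1 + \<delta>) * (1 - \<delta>))" by simp
  also have "\<dots> = a" by (simp add: abcd algebra_simps power2_eq_square)
  finally have a: "a > 0" .
  let ?p = "[:d, c, b, a:]" and ?q = "[:- d, c, - b, a:]"
  have p: "rate_cubic h \<delta> l = poly ?p l" for l
    unfolding rate_cubic_def abcd by (simp add: algebra_simps power2_eq_square power3_eq_cube)
  have q: "poly ?q l = - poly ?p (- l)" for l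
    by (simp add: algebra_simps)
  obtain m where m: "\<And>x. x \<ge> m \<Longrightarrow> poly ?p x \<ge> a"
    using poly_pinfty_gt_lc[of ?p] a by auto
  obtain n where n: "\<And>x. x \<ge> n \<Longrightarrow> poly ?q x \<ge> a"
    using poly_pinfty_gt_lc[of ?q] a by auto
  have "poly ?p (max 0 m) \<ge> 0" using m[of "max 0 m"] a by simp
  moreover have "poly ?p (- max 0 n) \<le> 0" using n[of "max 0 n"] a unfolding q by linarith
  moreover have "- max 0 n \<le> max 0 m" by linarith
  moreover have "continuous_on {- max 0 n..max 0 m} (poly ?p)"
    by (intro continuous_on_poly continuous_on_id)
  ultimately obtain r where r: "poly ?p r = 0"
    using IVT'[of "poly ?p" "- max 0 n" 0 "max 0 m"] by blast
  let ?R = "{l. rate_cubic h \<delta> l = 0}"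
  have fin: "finite ?R" using poly_roots_finite[of ?p] a by (simp only: p) simp
  have ne: "?R \<noteq> {}" using r p by auto
  have "rate_lambda h \<delta> = Max ?R" unfolding rate_lambda_def
    using Max_in[OF fin ne] Max_ge[OF fin] by (intro Greatest_equality) auto
  then show "rate_cubic h \<delta> (rate_lambda h \<delta>) = 0"
    and "rate_cubic h \<delta> l = 0 \<Longrightarrow> l \<le> rate_lambda h \<delta>"
    using Max_in[OF fin ne] Max_ge[OF fin] by auto
qed

definition rate_const :: "nat \<Rightarrow> real \<Rightarrow> real \<Rightarrow> real" where
  "rate_const N h \<delta> =
     (let l = rate_lambda h \<delta>;
          h1 = 3 / (2 * (1 + \<delta>));
          h2 = (3 * \<delta> + 2 - sqrt (4 - 3 * \<delta>\<^sup>2)) / (2 * \<delta> * (\<delta> + 1))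
      in if h < h1 then 1 / (real N * h * (1 - \<delta>) + 1 / 2)
         else if h \<le> h2 then
           2 * l / (real N * (h * l\<^sup>2 + 2 * (h - 1) * l + h - 1) + l)
         else 2 / (real N * (1 - h * (1 + \<delta>)) powi (- 2) - (real N - 1)))"

end

theory Submission
  imports Defs
begin

text \<open>
  For \<open>L = 1\<close>, every step from \<open>x\<close> to \<open>x'\<close> satisfies \<open>f x - f x' \<ge> p (norm g')\<^sup>2\<close> with one constant \<open>p\<close>
  depending on \<open>h\<close> and \<open>\<delta>\<close>. Summing over the steps and adding
  \<open>f (x N) - f xstar \<ge> (norm (g N))\<^sup>2 / 2\<close> gives the rate \<open>1 / (N p + 1 / 2)\<close>.
  The one-step bound adds the interpolation inequalities of the pair \<open>x, x'\<close> with weights \<open>1 + l\<close>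
  and \<open>l\<close> and minimizes over the inexact direction \<open>d\<close>; what remains is a binary quadratic form in
  \<open>norm g\<close> and \<open>norm ((1 + l) g' - l g)\<close>, and the three regimes correspond to the sign
  (negative, zero, positive) of its mixed inner product coefficient. In the middle regime this coefficient
  vanishes and the form is degenerate exactly when \<open>l\<close> is a root of the cubic.
\<close>

section \<open>Smooth convex functions\<close>

lemma GDERIV_along_line:
  fixes f :: "'a::euclidean_space \<Rightarrow> real"
  assumes "\<And>x. f differentiable (at x)"
  shows "((\<lambda>t. f (x + t *\<^sub>R v)) has_real_derivative (v \<bullet> gradient f (x + t *\<^sub>R v))) (at t)"
proof -
  have "(f has_derivative (\<lambda>u. u \<bullet> gradient f (x + t *\<^sub>R v))) (at (x + t *\<^sub>R v))"
    using GDERIV_gradient[OF assms] by (simp add: gderiv_def)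
  moreover have "((\<lambda>t. x + t *\<^sub>R v) has_derivative (\<lambda>u. u *\<^sub>R v)) (at t)"
    by (auto intro!: derivative_eq_intros)
  ultimately have "((\<lambda>t. f (x + t *\<^sub>R v)) has_derivative
      (\<lambda>u. (u *\<^sub>R v) \<bullet> gradient f (x + t *\<^sub>R v))) (at t)"
    using has_derivative_compose by blast
  then show ?thesis
    by (simp add: has_field_derivative_def mult_commute_abs)
qed

text \<open>The descent lemma. Along the segment, \<open>k\<close> is the quadratic model minus
  \<open>f\<close>, up to the constant \<open>f x\<close>; the Lipschitz bound makes its derivative
  nonnegative.\<close>

lemma smooth_with_upper_bound:
  fixes f :: "'a::euclidean_space \<Rightarrow> real"
  assumes "smooth_with L f"
  shows "f (x + v) \<le> f x + v \<bullet> gradient f x + L / 2 * (norm v)\<^sup>2"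
proof -
  have df: "\<And>x. f differentiable (at x)"
    and lip: "\<And>x y. norm (gradient f x - gradient f y) \<le> L * norm (x - y)"
    using assms by (auto simp: smooth_with_def)
  define k where "k t = (v \<bullet> gradient f x) * t + L / 2 * (norm v)\<^sup>2 * t\<^sup>2 - f (x + t *\<^sub>R v)" for t
  have "k 0 \<le> k 1"
  proof (rule DERIV_nonneg_imp_nondecreasing[where f = k])
    fix t :: real assume t: "0 \<le> t" "t \<le> 1"
    have "(k has_real_derivative
        (v \<bullet> gradient f x) + L * (norm v)\<^sup>2 * t - v \<bullet> gradient f (x + t *\<^sub>R v)) (at t)"
      unfolding k_def
      by (auto intro!: derivative_eq_intros GDERIV_along_line df)
    moreover have "v \<bullet> (gradient f (x + t *\<^sub>R v) - gradient f x) \<le> L * (norm v)\<^sup>2 * t"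
    proof -
      have "v \<bullet> (gradient f (x + t *\<^sub>R v) - gradient f x)
          \<le> norm v * norm (gradient f (x + t *\<^sub>R v) - gradient f x)"
        by (rule norm_cauchy_schwarz)
      also have "\<dots> \<le> norm v * (L * norm (x + t *\<^sub>R v - x))"
        by (intro mult_left_mono lip) auto
      also have "\<dots> = L * (norm v)\<^sup>2 * t"
        using t by (simp add: power2_eq_square)
      finally show ?thesis .
    qed
    ultimately show "\<exists>y. (k has_real_derivative y) (at t) \<and> 0 \<le> y"
      by (auto simp: inner_diff_right intro!: exI)
  qed simp
  then show ?thesis by (simp add: k_def)
qed

text \<open>The vector \<open>w\<close> is left free: the gradient itself yields the gap to the
  minimum, a difference of gradients the interpolation inequality.\<close>

lemma smooth_with_gradient_step:
  fixes f :: "'a::euclidean_space \<Rightarrow> real"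
  assumes "smooth_with L f" "L > 0"
  shows "f (x - (1 / L) *\<^sub>R w) \<le> f x - (w \<bullet> gradient f x) / L + (norm w)\<^sup>2 / (2 * L)"
  using smooth_with_upper_bound[OF assms(1), of x "- (1 / L) *\<^sub>R w"] assms(2)
  by (simp add: power2_eq_square field_simps)

lemma smooth_with_gap:
  fixes f :: "'a::euclidean_space \<Rightarrow> real"
  assumes "smooth_with L f" "L > 0" "\<forall>y. f xstar \<le> f y"
  shows "(norm (gradient f x))\<^sup>2 / (2 * L) \<le> f x - f xstar"
proof -
  have "f xstar \<le> f (x - (1 / L) *\<^sub>R gradient f x)" using assms(3) by blast
  also have "\<dots> \<le> f x - (norm (gradient f x))\<^sup>2 / (2 * L)"
    using smooth_with_gradient_step[OF assms(1,2), of x "gradient f x"] assms(2)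
    by (simp add: power2_norm_eq_inner field_simps)
  finally show ?thesis by simp
qed

lemma convex_above_tangent:
  fixes f :: "'a::euclidean_space \<Rightarrow> real"
  assumes "convex_on UNIV f" "\<And>x. f differentiable (at x)"
  shows "f y + (z - y) \<bullet> gradient f y \<le> f z"
proof -
  let ?k = "\<lambda>t. f (y + t *\<^sub>R (z - y))"
  have "convex_on UNIV ?k"
  proof (rule convex_onI)
    fix t a b :: real assume t: "0 < t" "t < 1"
    have "y + ((1 - t) *\<^sub>R a + t *\<^sub>R b) *\<^sub>R (z - y)
        = (1 - t) *\<^sub>R (y + a *\<^sub>R (z - y)) + t *\<^sub>R (y + b *\<^sub>R (z - y))"
      by (simp add: algebra_simps)
    then show "?k ((1 - t) *\<^sub>R a + t *\<^sub>R b) \<le> (1 - t) * ?k a + t * ?k b"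
      using convex_onD[OF assms(1), of t "y + a *\<^sub>R (z - y)" "y + b *\<^sub>R (z - y)"] t by simp
  qed simp
  moreover have "(?k has_real_derivative ((z - y) \<bullet> gradient f y)) (at 0 within UNIV)"
    using GDERIV_along_line[OF assms(2), of y "z - y" 0] by simp
  ultimately have "?k 1 - ?k 0 \<ge> ((z - y) \<bullet> gradient f y) * (1 - 0)"
    by (intro convex_on_imp_above_tangent[where A=UNIV]) auto
  then show ?thesis by simp
qed

text \<open>At \<open>x - (1 / L) *\<^sub>R w\<close> the tangent at \<open>y\<close> bounds
  \<open>f\<close> from below and the descent lemma bounds it from above. The linear terms differ by
  \<open>(norm w)\<^sup>2 / L\<close>, half of which the quadratic term consumes.\<close>

lemma smooth_convex_interpolation:
  fixes f :: "'a::euclidean_space \<Rightarrow> real"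
  assumes "convex_on UNIV f" "smooth_with L f" "L > 0"
  shows "f y + (x - y) \<bullet> gradient f y + (norm (gradient f x - gradient f y))\<^sup>2 / (2 * L) \<le> f x"
proof -
  define w where "w = gradient f x - gradient f y"
  have "f y + (x - (1 / L) *\<^sub>R w - y) \<bullet> gradient f y \<le> f (x - (1 / L) *\<^sub>R w)"
    using assms by (intro convex_above_tangent) (auto simp: smooth_with_def)
  also have "\<dots> \<le> f x - (w \<bullet> gradient f x) / L + (norm w)\<^sup>2 / (2 * L)"
    using assms by (intro smooth_with_gradient_step)
  finally have "f y + (x - y) \<bullet> gradient f y - (w \<bullet> gradient f y) / L
      \<le> f x - (w \<bullet> gradient f x) / L + (norm w)\<^sup>2 / (2 * L)"
    by (simp add: inner_diff_left)
  moreover have "(w \<bullet> gradient f x) / L - (w \<bullet> gradient f y) / L = (norm w)\<^sup>2 / L"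
    by (simp add: power2_norm_eq_inner w_def inner_diff_right diff_divide_distrib)
  moreover have "(norm w)\<^sup>2 / L = 2 * ((norm w)\<^sup>2 / (2 * L))" by simp
  ultimately show ?thesis unfolding w_def by linarith
qed

section \<open>One step of the method\<close>

text \<open>AM-GM on the two squares, in squared form to avoid the root of \<open>a * b\<close>.
  Here \<open>i\<close> stands for the inner product of two vectors of norms \<open>G\<close> and
  \<open>V\<close>.\<close>

lemma binary_form_nonneg:
  fixes a b m c G V i :: real
  assumes "0 \<le> a" "0 \<le> b" "0 \<le> c" "(\<bar>m\<bar> + c)\<^sup>2 \<le> 4 * a * b"
    and "0 \<le> G" "0 \<le> V" "\<bar>i\<bar> \<le> G * V"
  shows "0 \<le> a * G\<^sup>2 + b * V\<^sup>2 + m * i - c * (G * V)"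
proof -
  have "((\<bar>m\<bar> + c) * (G * V))\<^sup>2 = (\<bar>m\<bar> + c)\<^sup>2 * (G * V)\<^sup>2"
    by (rule power_mult_distrib)
  also have "\<dots> \<le> 4 * a * b * (G * V)\<^sup>2"
    using assms(4) by (intro mult_right_mono) auto
  also have "\<dots> \<le> (a * G\<^sup>2 + b * V\<^sup>2)\<^sup>2"
    using zero_le_power2[of "a * G\<^sup>2 - b * V\<^sup>2"]
    by (simp add: power2_eq_square algebra_simps)
  finally have "(\<bar>m\<bar> + c) * (G * V) \<le> a * G\<^sup>2 + b * V\<^sup>2"
    by (rule power2_le_imp_le) (use assms in auto)
  moreover have "\<bar>m * i\<bar> \<le> \<bar>m\<bar> * (G * V)"
    unfolding abs_mult using assms by (intro mult_left_mono) auto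
  ultimately show ?thesis by (simp add: algebra_simps)
qed

text \<open>The multiplier \<open>l\<close> combines \<open>1 + l\<close> times the interpolation inequality from \<open>x\<close> to
  the new point with \<open>l\<close> times its reverse. The form is written in
  \<open>v = (1 + l) g' - l g\<close>, the vector paired with \<open>d\<close>, so that the worst \<open>d\<close> is explicit.\<close>

lemma inexact_step_decrease:
  fixes f :: "'a::euclidean_space \<Rightarrow> real"
  assumes f: "convex_on UNIV f" "smooth_with L f" "L > 0"
    and d: "norm (d - gradient f x) \<le> \<delta> * norm (gradient f x)"
    and "0 \<le> h" "0 \<le> \<delta>" "0 \<le> l"
    and a: "0 \<le> (1 + 2 * l) / 2 - p * l\<^sup>2" and b: "0 \<le> (1 + 2 * l) / 2 - p"
    and disc: "(\<bar>h * (1 + l)\<^sup>2 - (1 + 2 * l) - 2 * p * l\<bar> + h * \<delta> * (1 + l)\<^sup>2)\<^sup>2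
       \<le> 4 * ((1 + 2 * l) / 2 - p * l\<^sup>2) * ((1 + 2 * l) / 2 - p)"
  shows "p * (norm (gradient f (x - (h / L) *\<^sub>R d)))\<^sup>2 / L \<le> f x - f (x - (h / L) *\<^sub>R d)"
proof -
  define y where "y = x - (h / L) *\<^sub>R d"
  define g where "g = gradient f x"
  define g' where "g' = gradient f y"
  define v where "v = (1 + l) *\<^sub>R g' - l *\<^sub>R g"
  define D where "D = L * (f x - f y)"
  note L = \<open>L > 0\<close>
  have A: "h * (d \<bullet> g') + (norm (g - g'))\<^sup>2 / 2 \<le> D"
  proof -
    have "x - y = (h / L) *\<^sub>R d" by (simp add: y_def)
    then have "f y + (h * (d \<bullet> g') + (norm (g - g'))\<^sup>2 / 2) / L \<le> f x"
      using smooth_convex_interpolation[OF f, of y x]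
      by (simp add: g_def g'_def add_divide_distrib)
    then show ?thesis using L by (simp add: D_def pos_divide_le_eq le_diff_eq field_simps)
  qed
  have B: "D \<le> h * (d \<bullet> g) - (norm (g - g'))\<^sup>2 / 2"
  proof -
    have "y - x = - (h / L) *\<^sub>R d" by (simp add: y_def)
    then have "f x + ((norm (g - g'))\<^sup>2 / 2 - h * (d \<bullet> g)) / L \<le> f y"
      using smooth_convex_interpolation[OF f, of x y]
      by (simp add: g_def g'_def diff_divide_distrib norm_minus_commute)
    then show ?thesis using L by (simp add: D_def field_simps)
  qed
  \<comment> \<open>Since \<open>(1 + l) * D - l * D = D\<close>, the weighted lower bound minus the
    weighted upper bound again bounds \<open>D\<close> from below, now with \<open>d\<close> paired
    only with \<open>v\<close>.\<close>
  have "(1 + l) * (h * (d \<bullet> g') + (norm (g - g'))\<^sup>2 / 2) \<le> (1 + l) * D"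
    using A \<open>0 \<le> l\<close> by (intro mult_left_mono) auto
  moreover have "l * D \<le> l * (h * (d \<bullet> g) - (norm (g - g'))\<^sup>2 / 2)"
    using B \<open>0 \<le> l\<close> by (intro mult_left_mono) auto
  ultimately have D: "h * (v \<bullet> d) + (1 + 2 * l) / 2 * (norm (g - g'))\<^sup>2 \<le> D"
    by (simp add: v_def inner_diff_left inner_commute algebra_simps add_divide_distrib)
  \<comment> \<open>In the worst case \<open>d - g\<close> is opposite to \<open>v\<close> and as
    long as the error bound allows.\<close>
  have "\<bar>v \<bullet> (d - g)\<bar> \<le> norm v * norm (d - g)" by (rule Cauchy_Schwarz_ineq2)
  also have "\<dots> \<le> norm v * (\<delta> * norm g)"
    using d by (intro mult_left_mono) (auto simp: g_def)
  finally have "v \<bullet> g - \<delta> * (norm g * norm v) \<le> v \<bullet> d"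
    by (simp add: inner_diff_right algebra_simps)
  then have "h * (v \<bullet> g - \<delta> * (norm g * norm v)) \<le> h * (v \<bullet> d)"
    using \<open>0 \<le> h\<close> by (rule mult_left_mono)
  with D have D: "h * (v \<bullet> g) - h * \<delta> * (norm g * norm v)
      + (1 + 2 * l) / 2 * (norm (g - g'))\<^sup>2 \<le> D"
    by (simp add: algebra_simps)
  \<comment> \<open>The factor \<open>(1 + l)\<^sup>2\<close> clears the denominators that arise
    when \<open>g'\<close> is expressed through \<open>g\<close> and \<open>v\<close>.\<close>
  have "0 \<le> ((1 + 2 * l) / 2 - p * l\<^sup>2) * (norm g)\<^sup>2 + ((1 + 2 * l) / 2 - p) * (norm v)\<^sup>2
      + (h * (1 + l)\<^sup>2 - (1 + 2 * l) - 2 * p * l) * (v \<bullet> g)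
      - h * \<delta> * (1 + l)\<^sup>2 * (norm g * norm v)"
    using Cauchy_Schwarz_ineq2[of v g] assms
    by (intro binary_form_nonneg) (auto simp: mult.commute)
  also have "\<dots> = (1 + l)\<^sup>2 * (h * (v \<bullet> g) - h * \<delta> * (norm g * norm v)
      + (1 + 2 * l) / 2 * (norm (g - g'))\<^sup>2 - p * (norm g')\<^sup>2)"
  proof -
    have "(1 + l)\<^sup>2 * (norm g')\<^sup>2 = (norm (v + l *\<^sub>R g))\<^sup>2"
      by (simp add: v_def power_mult_distrib)
    also have "\<dots> = (norm v)\<^sup>2 + 2 * l * (v \<bullet> g) + l\<^sup>2 * (norm g)\<^sup>2"
      unfolding power2_norm_eq_inner
      by (simp add: inner_add_left inner_add_right inner_commute power2_eq_square)
    finally have 1: "(1 + l)\<^sup>2 * (norm g')\<^sup>2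
        = (norm v)\<^sup>2 + 2 * l * (v \<bullet> g) + l\<^sup>2 * (norm g)\<^sup>2" .
    have "(1 + l)\<^sup>2 * (norm (g - g'))\<^sup>2 = (norm ((1 + l) *\<^sub>R (g - g')))\<^sup>2"
      by (simp add: power_mult_distrib)
    also have "(1 + l) *\<^sub>R (g - g') = g - v" by (simp add: v_def algebra_simps)
    also have "(norm (g - v))\<^sup>2 = (norm g)\<^sup>2 - 2 * (v \<bullet> g) + (norm v)\<^sup>2"
      unfolding power2_norm_eq_inner
      by (simp add: inner_diff_left inner_diff_right inner_commute)
    finally have 2: "(1 + l)\<^sup>2 * (norm (g - g'))\<^sup>2 = (norm g)\<^sup>2 - 2 * (v \<bullet> g) + (norm v)\<^sup>2" .
    have eq: "A * (u + (1 + 2 * l) / 2 * s - p * t)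
        = A * u + (1 + 2 * l) / 2 * (A * s) - p * (A * t)" for A u s t
      by (simp add: field_simps)
    show ?thesis unfolding eq 1 2 by (simp add: field_simps)
  qed
  finally have "0 \<le> h * (v \<bullet> g) - h * \<delta> * (norm g * norm v)
      + (1 + 2 * l) / 2 * (norm (g - g'))\<^sup>2 - p * (norm g')\<^sup>2"
    using \<open>0 \<le> l\<close> by (simp add: zero_le_mult_iff)
  with D have "p * (norm g')\<^sup>2 \<le> D" by linarith
  then show ?thesis
    using L by (simp add: D_def y_def[symmetric] g'_def pos_divide_le_eq mult.commute)
qed

text \<open>With \<open>M\<close> the least squared gradient norm, telescoping gives a decrease of
  at least \<open>N * p * M / L\<close>. The gap left at \<open>x N\<close> is at least
  \<open>M / (2 * L)\<close>, which accounts for the summand \<open>1 / 2\<close>.\<close>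

lemma inexact_gd_rate:
  fixes f :: "'a::euclidean_space \<Rightarrow> real"
  assumes f: "smooth_with L f" "L > 0" "\<forall>y. f xstar \<le> f y"
    and "0 \<le> p" "N \<ge> 1"
    and step: "\<And>k. k < N \<Longrightarrow> p * (norm (gradient f (x (Suc k))))\<^sup>2 / L \<le> f (x k) - f (x (Suc k))"
  shows "1 / L * Min ((\<lambda>k. (norm (gradient f (x k)))\<^sup>2) ` {1..N})
    \<le> 1 / (real N * p + 1 / 2) * (f (x 0) - f xstar)"
proof -
  define M where "M = Min ((\<lambda>k. (norm (gradient f (x k)))\<^sup>2) ` {1..N})"
  have M: "M \<le> (norm (gradient f (x k)))\<^sup>2" if "k \<in> {1..N}" for k
    unfolding M_def using that by (intro Min_le) auto
  have "real n * (p * M / L) \<le> f (x 0) - f (x n)" if "n \<le> N" for n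
    using that
  proof (induction n)
    case (Suc n)
    have "p * M / L \<le> p * (norm (gradient f (x (Suc n))))\<^sup>2 / L"
      using Suc.prems assms(2,4) by (intro divide_right_mono mult_left_mono M) auto
    also have "\<dots> \<le> f (x n) - f (x (Suc n))" using Suc.prems by (intro step) auto
    finally show ?case using Suc by (simp add: distrib_right add_divide_distrib)
  qed simp
  from this[of N] have "real N * (p * M / L) \<le> f (x 0) - f (x N)" by simp
  moreover have "M / (2 * L) \<le> f (x N) - f xstar"
  proof -
    have "M / (2 * L) \<le> (norm (gradient f (x N)))\<^sup>2 / (2 * L)"
      using assms by (intro divide_right_mono M) auto
    then show ?thesis using smooth_with_gap[OF f, of "x N"] by linarith
  qed
  ultimately have "(real N * p + 1 / 2) * (M / L) \<le> f (x 0) - f xstar"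
    by (simp add: algebra_simps)
  moreover have "0 < real N * p + 1 / 2" using \<open>0 \<le> p\<close> by (simp add: add_nonneg_pos)
  ultimately show ?thesis
    unfolding M_def[symmetric] by (simp add: pos_le_divide_eq mult.commute)
qed

section \<open>The cubic in the middle regime\<close>

text \<open>The substitution \<open>l = (1 - q) / q\<close>, i.e.\ \<open>q = 1 / (1 + l)\<close>.\<close>

lemma rate_cubic_reciprocal:
  assumes "q \<noteq> 0"
  shows "q ^ 3 * rate_cubic h \<delta> ((1 - q) / q)
    = h * (2 - q) - q * (2 - q)\<^sup>2 - h\<^sup>2 * (1 - \<delta>\<^sup>2) * (1 - q)"
proof -
  have eq: "q ^ 3 * (a * ((1 - q) / q) ^ 3 + b * ((1 - q) / q)\<^sup>2 + c * ((1 - q) / q) + d)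
      = a * (1 - q) ^ 3 + b * (1 - q)\<^sup>2 * q + c * (1 - q) * q\<^sup>2 + d * q ^ 3" for a b c d
    using assms by (simp add: field_simps power2_eq_square power3_eq_cube)
  show ?thesis unfolding rate_cubic_def eq by algebra
qed

text \<open>The value of \<open>p\<close> that makes the mixed coefficient in
  \<open>inexact_step_decrease\<close> vanish for \<open>l = rate_lambda h \<delta>\<close>.\<close>

definition middle_gain :: "real \<Rightarrow> real \<Rightarrow> real" where
  "middle_gain h \<delta> = (h * (1 + rate_lambda h \<delta>)\<^sup>2 - (1 + 2 * rate_lambda h \<delta>)) / (2 * rate_lambda h \<delta>)"

text \<open>The parameter \<open>r\<close> removes the square root from the regime:
  \<open>1 / 2 \<le> r\<close> says that \<open>h\<close> is at least the first breakpoint and,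
  given \<open>r < 1\<close>, \<open>h_r\<close> says that it is at most the second.\<close>

locale middle_regime =
  fixes h \<delta> r :: real
  assumes \<delta>: "0 < \<delta>" "\<delta> < 1"
    and r_def: "r = h * (1 + \<delta>) - 1"
    and r: "1 / 2 \<le> r" "r < 1"
    and h_r: "h * r \<le> r\<^sup>2 - r + 1"
begin

lemma h_pos: "0 < h"
proof -
  have "0 < h * (1 + \<delta>)" using r(1) by (simp add: r_def)
  then show ?thesis using \<delta> by (simp add: zero_less_mult_iff)
qed

text \<open>On this range of \<open>r\<close>, the bound \<open>(r\<^sup>2 - r + 1) / r\<close> on
  \<open>h\<close> is at most \<open>2 - r\<close>.\<close>

lemma h_le: "h \<le> 2 - r"
proof -
  have "0 \<le> (2 * r - 1) * (1 - r)" using r by simp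
  then have "h * r \<le> (2 - r) * r" using h_r by (simp add: algebra_simps power2_eq_square)
  then show ?thesis using r by simp
qed

text \<open>The cubic in the reciprocal variable \<open>q = 1 / (1 + l)\<close>; for positive
  \<open>q\<close>, the condition \<open>1 \<le> r * (1 + l)\<close> becomes
  \<open>q \<le> r\<close>.\<close>

definition q_cubic :: "real \<Rightarrow> real" where
  "q_cubic q = h * (2 - q) - q * (2 - q)\<^sup>2 - h\<^sup>2 * (1 - \<delta>\<^sup>2) * (1 - q)"

lemma q_cubic_half: "0 \<le> q_cubic (1 / 2)"
proof -
  have "q_cubic (1 / 2) = (2 * r - 1) * (2 * r + 5 - 4 * h) / 8"
    unfolding q_cubic_def r_def by (simp add: power2_eq_square field_simps)
  moreover have "4 * h \<le> 2 * r + 5" using h_le r by simp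
  moreover have "0 \<le> (2 * r - 1) * (2 * r + 5 - 4 * h) / 8"
    using calculation(2) r by (intro divide_nonneg_pos mult_nonneg_nonneg) auto
  ultimately show ?thesis by simp
qed

text \<open>One factor vanishes at the first breakpoint and the other at the second, so
  \<open>r\<close> is itself a root at both ends of the regime.\<close>

lemma q_cubic_r: "q_cubic r = - ((2 * r - 1) * (r\<^sup>2 - r + 1 - h * r))"
  unfolding q_cubic_def r_def by algebra

lemma q_cubic_r_nonpos: "q_cubic r \<le> 0"
  using r h_r by (simp add: q_cubic_r)

text \<open>\<open>q_cubic q / (1 - q)\<close> is strictly decreasing on \<open>{0<..r}\<close>: \<open>K\<close> is a divided difference.\<close>

lemma q_cubic_no_two_roots:
  assumes q: "0 < q" "q < q'" "q' \<le> r" and root: "q_cubic q = 0" "q_cubic q' = 0"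
  shows False
proof -
  define K where "K a b = (2 - a - b)\<^sup>2 + a * b * (3 - a - b)" for a b :: real
  \<comment> \<open>Two roots would force \<open>h = K q q'\<close>. But moving both arguments of
    \<open>K\<close> up to \<open>r\<close> lowers its value strictly, and \<open>K r r\<close> is
    already at least \<open>h\<close>.\<close>
  have "(q' - q) * (h - K q q') = (1 - q) * q_cubic q' - (1 - q') * q_cubic q"
    unfolding K_def q_cubic_def by algebra
  with root q have "h = K q q'" by simp
  moreover have "K q q' - K r q' = (r - q) * ((1 - q') * (4 - q' - q - r))"
    unfolding K_def by algebra
  moreover have "0 < (r - q) * ((1 - q') * (4 - q' - q - r))" using q r by simp
  moreover have "K r q' - K r r = (r - q') * ((1 - r) * (4 - r - q' - r))"
    unfolding K_def by algebra
  moreover have "0 \<le> (r - q') * ((1 - r) * (4 - r - q' - r))" using q r by simp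
  moreover have "h \<le> K r r"
  proof -
    have "r * K r r - (r\<^sup>2 - r + 1) = (2 * r - 1) * (1 - r) ^ 3"
      unfolding K_def by algebra
    moreover have "0 \<le> (2 * r - 1) * (1 - r) ^ 3" using r by simp
    ultimately have "r * h \<le> r * K r r" using h_r by (simp add: mult.commute)
    then show ?thesis using r by simp
  qed
  ultimately show False by linarith
qed

text \<open>The side condition places \<open>1 / (1 + l)\<close> in the interval where
  \<open>q_cubic\<close> has at most one root. It passes to every larger root, hence to the greatest
  one.\<close>

lemma rate_cubic_unique_root:
  assumes "rate_cubic h \<delta> l = 0" "rate_cubic h \<delta> l' = 0"
    and "1 \<le> r * (1 + l)" "1 \<le> r * (1 + l')"
  shows "l = l'"
proof -
  have q: "0 < 1 / (1 + k) \<and> 1 / (1 + k) \<le> r \<and> q_cubic (1 / (1 + k)) = 0"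
    if k: "rate_cubic h \<delta> k = 0" "1 \<le> r * (1 + k)" for k
  proof -
    have "0 < r * (1 + k)" using k(2) by linarith
    then have pos: "0 < 1 + k" using r by (simp add: zero_less_mult_iff)
    then have "(1 - 1 / (1 + k)) / (1 / (1 + k)) = k" by (simp add: field_simps)
    then have "q_cubic (1 / (1 + k)) = 0"
      using rate_cubic_reciprocal[of "1 / (1 + k)" h \<delta>] pos k(1) by (simp add: q_cubic_def)
    then show ?thesis using pos k(2) by (simp add: pos_divide_le_eq)
  qed
  have "1 / (1 + l) = 1 / (1 + l')"
    using q_cubic_no_two_roots[of "1 / (1 + l)" "1 / (1 + l')"]
      q_cubic_no_two_roots[of "1 / (1 + l')" "1 / (1 + l)"] q[of l] q[of l'] assms
    by (meson linorder_neqE_linordered_idom)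
  then show ?thesis by simp
qed

text \<open>The intermediate value theorem on \<open>{1 / 2..r}\<close> gives a root
  \<open>l \<le> 1\<close> that meets the side condition. The greatest root meets it too, so
  uniqueness identifies the two and transfers \<open>l \<le> 1\<close>.\<close>

lemma rate_lambda_root: "rate_cubic h \<delta> (rate_lambda h \<delta>) = 0"
  and rate_lambda_ge: "1 \<le> r * (1 + rate_lambda h \<delta>)"
  and rate_lambda_le: "rate_lambda h \<delta> \<le> 1"
proof -
  have "\<exists>q\<ge>1 / 2. q \<le> r \<and> q_cubic q = 0"
    using q_cubic_half q_cubic_r_nonpos r
    by (intro IVT2') (auto simp: q_cubic_def intro!: continuous_intros)
  then obtain q where q: "1 / 2 \<le> q" "q \<le> r" "q_cubic q = 0" by blast
  define l where "l = (1 - q) / q"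
  have q0: "0 < q" using q by linarith
  then have l1: "1 + l = 1 / q" by (simp add: l_def field_simps)
  have root: "rate_cubic h \<delta> l = 0"
    using rate_cubic_reciprocal[of q h \<delta>] q q0 by (simp add: l_def q_cubic_def)
  have ge: "1 \<le> r * (1 + l)" using q q0 by (simp add: l1)
  have "h \<le> 2 / (1 + \<delta>)" using r \<delta> by (simp add: r_def pos_le_divide_eq)
  note greatest = rate_lambda_greatest_root[OF \<delta> h_pos this]
  show 1: "rate_cubic h \<delta> (rate_lambda h \<delta>) = 0" by (rule greatest)
  have "r * (1 + l) \<le> r * (1 + rate_lambda h \<delta>)"
    using greatest(2)[OF root] r by (intro mult_left_mono) auto
  with ge show 2: "1 \<le> r * (1 + rate_lambda h \<delta>)" by linarith
  have "rate_lambda h \<delta> = l" using rate_cubic_unique_root[OF 1 root 2 ge] .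
  then show "rate_lambda h \<delta> \<le> 1" using q q0 by (simp add: l_def pos_divide_le_eq)
qed

lemma rate_lambda_pos: "0 < rate_lambda h \<delta>"
proof (rule ccontr)
  assume "\<not> 0 < rate_lambda h \<delta>"
  then have "r * (1 + rate_lambda h \<delta>) \<le> r * 1" using r by (intro mult_left_mono) auto
  then show False using rate_lambda_ge r by linarith
qed

lemma rate_lambda_eqI: "rate_cubic h \<delta> l = 0 \<Longrightarrow> 1 \<le> r * (1 + l) \<Longrightarrow> l = rate_lambda h \<delta>"
  using rate_cubic_unique_root rate_lambda_root rate_lambda_ge by blast

abbreviation gain :: real where "gain \<equiv> middle_gain h \<delta>"

lemma gain_mult: "2 * gain * rate_lambda h \<delta> = h * (1 + rate_lambda h \<delta>)\<^sup>2 - (1 + 2 * rate_lambda h \<delta>)"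
  using rate_lambda_pos by (simp add: middle_gain_def)

text \<open>A negative gain would make both diagonal coefficients of the one-step form exceed half
  of \<open>1 + 2 * l\<close>, and their product would exceed the value that the cubic
  prescribes.\<close>

lemma gain_nonneg: "0 \<le> gain"
proof (rule ccontr)
  define l where "l = rate_lambda h \<delta>"
  define s where "s = 1 + 2 * l"
  have l: "0 < l" using rate_lambda_pos by (simp add: l_def)
  assume "\<not> 0 \<le> gain"
  then have "2 * gain * l < 0" using l by (simp add: mult_less_0_iff)
  then have lt: "h * (1 + l)\<^sup>2 < s" using gain_mult by (simp add: l_def s_def)
  have "l * (h * (1 + l)\<^sup>2) < l * s" using lt l by simp
  then have 1: "s < s * (1 + l) - h * l * (1 + l)\<^sup>2" by (simp add: algebra_simps)
  have 2: "s * l < s * (1 + l) - h * (1 + l)\<^sup>2" using lt by (simp add: algebra_simps)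
  \<comment> \<open>The factors on the right are \<open>2\<close> and \<open>2 * l\<close> times the
    two diagonal coefficients.\<close>
  have "s * (s * l) < (s * (1 + l) - h * l * (1 + l)\<^sup>2) * (s * (1 + l) - h * (1 + l)\<^sup>2)"
    using 1 2 l by (intro mult_strict_mono) (auto simp: s_def add_pos_pos)
  also have "\<dots> = l * (\<delta> * (h * (1 + l)\<^sup>2))\<^sup>2 - (1 + l)\<^sup>2 * rate_cubic h \<delta> l"
    unfolding rate_cubic_def s_def by algebra
  also have "\<dots> = l * (\<delta> * (h * (1 + l)\<^sup>2))\<^sup>2"
    using rate_lambda_root by (simp add: l_def)
  also have "\<dots> \<le> l * s\<^sup>2"
  proof -
    have "\<delta> * (h * (1 + l)\<^sup>2) \<le> 1 * s"
      using lt \<delta> h_pos by (intro mult_mono) auto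
    then show ?thesis using l \<delta> h_pos by (intro mult_left_mono power_mono) auto
  qed
  finally show False by (simp add: power2_eq_square mult.left_commute)
qed

text \<open>These are the hypotheses of \<open>inexact_step_decrease\<close>. The mixed coefficient
  is zero, and the cubic turns the discriminant condition into an equality.\<close>

lemma gain_certificate:
  fixes l defines "l \<equiv> rate_lambda h \<delta>"
  shows "0 \<le> (1 + 2 * l) / 2 - gain * l\<^sup>2" "0 \<le> (1 + 2 * l) / 2 - gain"
    and "(\<bar>h * (1 + l)\<^sup>2 - (1 + 2 * l) - 2 * gain * l\<bar> + h * \<delta> * (1 + l)\<^sup>2)\<^sup>2
       \<le> 4 * ((1 + 2 * l) / 2 - gain * l\<^sup>2) * ((1 + 2 * l) / 2 - gain)"
proof -
  have l: "0 < l" "l \<le> 1" using rate_lambda_pos rate_lambda_le by (auto simp: l_def)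
  note gm = gain_mult[folded l_def]
  \<comment> \<open>The left side is \<open>2 + 2 * l - r * (1 + l)\<close>, and the last product is
    at least \<open>1\<close>.\<close>
  have "(2 - r) * (1 + l) \<le> 1 + 2 * l"
    using rate_lambda_ge by (simp add: l_def[symmetric] algebra_simps)
  moreover have "h * (1 + l) \<le> (2 - r) * (1 + l)"
    using h_le l by (intro mult_right_mono) auto
  ultimately have "h * (1 + l) \<le> 1 + 2 * l" by linarith
  then have "h * (1 + l) * (1 + l) \<le> (1 + 2 * l) * (1 + l)"
    using l by (intro mult_right_mono) auto
  then have "2 * gain * l \<le> (1 + 2 * l) * l"
    unfolding gm by (simp add: algebra_simps power2_eq_square)
  then show b: "0 \<le> (1 + 2 * l) / 2 - gain" using l by simp
  have "gain * l\<^sup>2 \<le> gain"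
    using l gain_nonneg by (simp add: mult_left_le power_le_one)
  with b show "0 \<le> (1 + 2 * l) / 2 - gain * l\<^sup>2" by linarith
  \<comment> \<open>The factor \<open>l\<close> is inserted so that the gain occurs only as
    \<open>2 * gain * l\<close>, which \<open>gm\<close> rewrites.\<close>
  have "l * (4 * ((1 + 2 * l) / 2 - gain * l\<^sup>2) * ((1 + 2 * l) / 2 - gain))
      = ((1 + 2 * l) - l * (2 * gain * l)) * (l * (1 + 2 * l) - 2 * gain * l)"
    by (simp add: power2_eq_square field_simps)
  also have "\<dots> = l * (h * \<delta> * (1 + l)\<^sup>2)\<^sup>2 - (1 + l)\<^sup>2 * rate_cubic h \<delta> l"
    unfolding gm rate_cubic_def by algebra
  also have "\<dots> = l * (h * \<delta> * (1 + l)\<^sup>2)\<^sup>2"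
    using rate_lambda_root by (simp add: l_def)
  finally have "4 * ((1 + 2 * l) / 2 - gain * l\<^sup>2) * ((1 + 2 * l) / 2 - gain)
      = (h * \<delta> * (1 + l)\<^sup>2)\<^sup>2"
    using l by simp
  then show "(\<bar>h * (1 + l)\<^sup>2 - (1 + 2 * l) - 2 * gain * l\<bar> + h * \<delta> * (1 + l)\<^sup>2)\<^sup>2
       \<le> 4 * ((1 + 2 * l) / 2 - gain * l\<^sup>2) * ((1 + 2 * l) / 2 - gain)"
    unfolding gm by simp
qed

lemma rate_lambda_lower_end: "r = 1 / 2 \<Longrightarrow> rate_lambda h \<delta> = 1"
proof -
  assume half: "r = 1 / 2"
  have "1 \<le> 1 / 2 * (1 + rate_lambda h \<delta>)" using rate_lambda_ge unfolding half .
  then show ?thesis using rate_lambda_le by simp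
qed

text \<open>Where \<open>h r = r\<^sup>2 - r + 1\<close>, the middle regime meets the last one.\<close>

lemma rate_lambda_upper_end:
  assumes "h * r = r\<^sup>2 - r + 1"
  shows "rate_lambda h \<delta> = (1 - r) / r"
proof -
  have "rate_cubic h \<delta> ((1 - r) / r) = 0"
    using assms r rate_cubic_reciprocal[of r h \<delta>] q_cubic_r by (simp add: q_cubic_def)
  moreover have "1 \<le> r * (1 + (1 - r) / r)" using r by (simp add: distrib_left)
  ultimately show ?thesis using rate_lambda_eqI by simp
qed

end

section \<open>The three regimes\<close>

definition breakpoint1 :: "real \<Rightarrow> real" where
  "breakpoint1 \<delta> = 3 / (2 * (1 + \<delta>))"

definition breakpoint2 :: "real \<Rightarrow> real" where
  "breakpoint2 \<delta> = (3 * \<delta> + 2 - sqrt (4 - 3 * \<delta>\<^sup>2)) / (2 * \<delta> * (\<delta> + 1))"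

text \<open>For \<open>L = 1\<close>, the first value is the decrease per squared gradient norm when
  the gradient is constant and \<open>d\<close> is \<open>1 - \<delta>\<close> times it. The last is
  the ratio for half the squared norm with \<open>d\<close> equal to \<open>1 + \<delta>\<close>
  times the gradient.\<close>

definition step_gain :: "real \<Rightarrow> real \<Rightarrow> real" where
  "step_gain h \<delta> =
    (if h < breakpoint1 \<delta> then h * (1 - \<delta>)
     else if h \<le> breakpoint2 \<delta> then middle_gain h \<delta>
     else (1 / (h * (1 + \<delta>) - 1)\<^sup>2 - 1) / 2)"

lemma breakpoint1_iff:
  assumes "0 < \<delta>"
  shows "breakpoint1 \<delta> \<le> h \<longleftrightarrow> 1 / 2 \<le> h * (1 + \<delta>) - 1"
  using assms by (simp add: breakpoint1_def field_simps)

text \<open>In terms of \<open>r = h * (1 + \<delta>) - 1\<close>, the condition is the sign of a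
  quadratic with roots \<open>u < 1 < w\<close>, and \<open>breakpoint2\<close> is the stepsize with
  \<open>r = u\<close>. Since \<open>r \<le> 1 < w\<close>, only the factor \<open>u - r\<close>
  decides the sign.\<close>

lemma breakpoint2_props:
  assumes "0 < \<delta>" "\<delta> < 1"
  shows "breakpoint1 \<delta> < breakpoint2 \<delta>" "breakpoint2 \<delta> < 2 / (1 + \<delta>)"
    and "h * (1 + \<delta>) \<le> 2 \<Longrightarrow> h \<le> breakpoint2 \<delta> \<longleftrightarrow>
      h * (h * (1 + \<delta>) - 1) \<le> (h * (1 + \<delta>) - 1)\<^sup>2 - (h * (1 + \<delta>) - 1) + 1"
    and "h = breakpoint2 \<delta> \<Longrightarrow>
      h * (h * (1 + \<delta>) - 1) = (h * (1 + \<delta>) - 1)\<^sup>2 - (h * (1 + \<delta>) - 1) + 1"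
proof -
  define S where "S = sqrt (4 - 3 * \<delta>\<^sup>2)"
  have "\<delta>\<^sup>2 < 1" using assms by (simp add: power_less_one_iff abs_square_less_1)
  then have S2: "S\<^sup>2 = 4 - 3 * \<delta>\<^sup>2" and S0: "0 < S" by (simp_all add: S_def)
  \<comment> \<open>The two bounds on \<open>S\<close> are what places \<open>u\<close> strictly
    between \<open>1 / 2\<close> and \<open>1\<close>.\<close>
  have "(2 - \<delta>)\<^sup>2 < S\<^sup>2"
    using assms unfolding S2 by (simp add: power2_eq_square algebra_simps)
  then have S1: "2 - \<delta> < S" using S0 by (simp add: power_less_imp_less_base)
  have "S\<^sup>2 < 2\<^sup>2" using assms unfolding S2 by simp
  then have S3: "S < 2" by (rule power_less_imp_less_base) simp
  define u where "u = (2 + \<delta> - S) / (2 * \<delta>)"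
  define w where "w = (2 + \<delta> + S) / (2 * \<delta>)"
  have b2: "breakpoint2 \<delta> = (1 + u) / (1 + \<delta>)"
    using assms by (simp add: breakpoint2_def u_def S_def[symmetric] field_simps)
  have u: "1 / 2 < u" "u < 1" and w: "1 < w"
    using assms S1 S3 S0 by (simp_all add: u_def w_def field_simps)
  have b1: "breakpoint1 \<delta> = (3 / 2) / (1 + \<delta>)" by (simp add: breakpoint1_def)
  show "breakpoint1 \<delta> < breakpoint2 \<delta>" "breakpoint2 \<delta> < 2 / (1 + \<delta>)"
    unfolding b1 b2 using u assms by (intro divide_strict_right_mono; simp)+
  have sum: "\<delta> * (u + w) = 2 + \<delta>" using assms by (simp add: u_def w_def field_simps)
  have "(2 * \<delta> * u) * (2 * \<delta> * w) = (2 + \<delta>)\<^sup>2 - S\<^sup>2"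
  proof -
    have eqs: "2 * \<delta> * u = 2 + \<delta> - S" "2 * \<delta> * w = 2 + \<delta> + S"
      using assms by (simp_all add: u_def w_def)
    show ?thesis unfolding eqs by algebra
  qed
  then have "4 * \<delta> * (\<delta> * (u * w)) = 4 * \<delta> * (1 + \<delta>)"
    unfolding S2 by (simp add: power2_eq_square algebra_simps)
  then have prod: "\<delta> * (u * w) = 1 + \<delta>" using assms by simp
  define r where "r = h * (1 + \<delta>) - 1"
  have "(1 + \<delta>) * (r\<^sup>2 - r + 1 - h * r) = \<delta> * r\<^sup>2 - (2 + \<delta>) * r + (1 + \<delta>)"
    unfolding r_def by algebra
  also have "\<dots> = \<delta> * r\<^sup>2 - \<delta> * (u + w) * r + \<delta> * (u * w)"
    by (simp only: sum prod)
  also have "\<dots> = \<delta> * (w - r) * (u - r)" by algebra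
  finally have fact: "(1 + \<delta>) * (r\<^sup>2 - r + 1 - h * r) = \<delta> * (w - r) * (u - r)" .
  have le_iff: "h \<le> breakpoint2 \<delta> \<longleftrightarrow> r \<le> u"
    using assms by (simp add: b2 r_def pos_le_divide_eq algebra_simps)
  show "h \<le> breakpoint2 \<delta> \<longleftrightarrow>
      h * (h * (1 + \<delta>) - 1) \<le> (h * (1 + \<delta>) - 1)\<^sup>2 - (h * (1 + \<delta>) - 1) + 1"
    if "h * (1 + \<delta>) \<le> 2"
  proof -
    have "0 < \<delta> * (w - r)" using that w assms by (simp add: r_def)
    then have "r \<le> u \<longleftrightarrow> 0 \<le> (1 + \<delta>) * (r\<^sup>2 - r + 1 - h * r)"
      unfolding fact zero_le_mult_iff[of "\<delta> * (w - r)"] by linarith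
    then show ?thesis using le_iff assms by (simp add: r_def[symmetric] zero_le_mult_iff)
  qed
  show "h * (h * (1 + \<delta>) - 1) = (h * (1 + \<delta>) - 1)\<^sup>2 - (h * (1 + \<delta>) - 1) + 1"
    if "h = breakpoint2 \<delta>"
  proof -
    have "r = u" using that assms by (simp add: r_def b2)
    then show ?thesis using fact assms by (simp add: r_def[symmetric])
  qed
qed

lemma middle_regimeI:
  assumes "0 < \<delta>" "\<delta> < 1" "breakpoint1 \<delta> \<le> h" "h \<le> breakpoint2 \<delta>"
  shows "middle_regime h \<delta> (h * (1 + \<delta>) - 1)"
proof -
  have "h < 2 / (1 + \<delta>)" using breakpoint2_props(2)[OF assms(1,2)] assms(4) by simp
  then have "h * (1 + \<delta>) < 2" using assms by (simp add: pos_less_divide_eq)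
  then show ?thesis
    using assms breakpoint1_iff[OF assms(1), of h] breakpoint2_props(3)[OF assms(1,2), of h]
    by unfold_locales auto
qed

text \<open>The left endpoint is included because the last formula is also evaluated there to prove
  continuity.\<close>

lemma last_regime:
  assumes "0 < \<delta>" "\<delta> < 1" "breakpoint2 \<delta> \<le> h" "h \<le> 2 / (1 + \<delta>)"
  shows "1 / 2 < h * (1 + \<delta>) - 1" "h * (1 + \<delta>) - 1 \<le> 1"
proof -
  have "breakpoint1 \<delta> < h" using breakpoint2_props(1)[OF assms(1,2)] assms(3) by simp
  then show "1 / 2 < h * (1 + \<delta>) - 1"
    using assms by (simp add: breakpoint1_def field_simps)
  show "h * (1 + \<delta>) - 1 \<le> 1" using assms by (simp add: pos_le_divide_eq)
qed

lemma step_gain_nonneg: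
  assumes "0 < \<delta>" "\<delta> < 1" "0 \<le> h" "h \<le> 2 / (1 + \<delta>)"
  shows "0 \<le> step_gain h \<delta>"
proof -
  consider (first) "h < breakpoint1 \<delta>" | (middle) "breakpoint1 \<delta> \<le> h" "h \<le> breakpoint2 \<delta>"
    | (last) "breakpoint1 \<delta> \<le> h" "breakpoint2 \<delta> < h" by linarith
  then show ?thesis
  proof cases
    case first
    then show ?thesis using assms by (simp add: step_gain_def)
  next
    case middle
    then show ?thesis
      using middle_regime.gain_nonneg[OF middle_regimeI[OF assms(1,2) middle]]
      by (simp add: step_gain_def)
  next
    case last
    note r = last_regime[OF assms(1,2) less_imp_le[OF last(2)] assms(4)]
    then have "0 < (h * (1 + \<delta>) - 1)\<^sup>2" "(h * (1 + \<delta>) - 1)\<^sup>2 \<le> 1"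
      by (simp_all add: power_le_one)
    then show ?thesis using last by (simp add: step_gain_def)
  qed
qed

lemma rate_const_eq:
  assumes "0 < \<delta>" "\<delta> < 1" "0 \<le> h" "h \<le> 2 / (1 + \<delta>)"
  shows "rate_const N h \<delta> = 1 / (real N * step_gain h \<delta> + 1 / 2)"
proof -
  consider (first) "h < breakpoint1 \<delta>" | (middle) "breakpoint1 \<delta> \<le> h" "h \<le> breakpoint2 \<delta>"
    | (last) "breakpoint1 \<delta> \<le> h" "breakpoint2 \<delta> < h" by linarith
  then show ?thesis
  proof cases
    case first
    then show ?thesis
      by (simp add: rate_const_def step_gain_def breakpoint1_def mult.assoc)
  next
    case middle
    interpret middle_regime h \<delta> "h * (1 + \<delta>) - 1" by (rule middle_regimeI[OF assms(1,2) middle])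
    define l where "l = rate_lambda h \<delta>"
    have "h * l\<^sup>2 + 2 * (h - 1) * l + h - 1 = 2 * gain * l"
      unfolding l_def gain_mult by algebra
    then have "real N * (h * l\<^sup>2 + 2 * (h - 1) * l + h - 1) + l = 2 * l * (real N * gain + 1 / 2)"
      by (simp add: algebra_simps)
    moreover have "2 * l / (2 * l * (real N * gain + 1 / 2)) = 1 / (real N * gain + 1 / 2)"
      using rate_lambda_pos by (simp add: l_def)
    ultimately show ?thesis
      using middle
      by (simp add: rate_const_def step_gain_def breakpoint1_def breakpoint2_def l_def)
  next
    case last
    have "(1 - h * (1 + \<delta>)) powi (- 2) = 1 / (h * (1 + \<delta>) - 1)\<^sup>2"
      by (simp add: power_int_minus power2_commute inverse_eq_divide)
    then have "rate_const N h \<delta> = 2 / (real N / (h * (1 + \<delta>) - 1)\<^sup>2 - (real N - 1))"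
      using last by (simp add: rate_const_def breakpoint1_def breakpoint2_def)
    also have "real N / (h * (1 + \<delta>) - 1)\<^sup>2 - (real N - 1) = 2 * (real N * step_gain h \<delta> + 1 / 2)"
      using last by (simp add: step_gain_def) (simp add: right_diff_distrib diff_divide_distrib)
    also have "2 / (2 * (real N * step_gain h \<delta> + 1 / 2)) = 1 / (real N * step_gain h \<delta> + 1 / 2)"
      by (metis mult_divide_mult_cancel_left_if mult.right_neutral zero_neq_numeral)
    finally show ?thesis .
  qed
qed

lemma step_gain_decrease:
  fixes f :: "'a::euclidean_space \<Rightarrow> real"
  assumes f: "convex_on UNIV f" "smooth_with L f" "L > 0"
    and d: "norm (d - gradient f x) \<le> \<delta> * norm (gradient f x)"
    and h: "0 < \<delta>" "\<delta> < 1" "0 \<le> h" "h \<le> 2 / (1 + \<delta>)"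
  shows "step_gain h \<delta> * (norm (gradient f (x - (h / L) *\<^sub>R d)))\<^sup>2 / L
    \<le> f x - f (x - (h / L) *\<^sub>R d)"
proof -
  note step = inexact_step_decrease[OF f d h(3) less_imp_le[OF h(1)]]
  consider (first) "h < breakpoint1 \<delta>" | (middle) "breakpoint1 \<delta> \<le> h" "h \<le> breakpoint2 \<delta>"
    | (last) "breakpoint1 \<delta> \<le> h" "breakpoint2 \<delta> < h" by linarith
  then show ?thesis
  proof cases
    case first
    \<comment> \<open>With \<open>l = 1\<close> both diagonal coefficients equal
      \<open>3 / 2 - h * (1 - \<delta>)\<close>. This bound makes the mixed coefficient negative,
      and the discriminant condition is an equality.\<close>
    then have "h * (1 + \<delta>) < 3 / 2" using h by (simp add: breakpoint1_def field_simps)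
    moreover have "h * (1 - \<delta>) \<le> h * (1 + \<delta>)" using h by (intro mult_left_mono) auto
    ultimately have "0 \<le> 3 / 2 - h * (1 - \<delta>)"
      "\<bar>h * 4 - 3 - 2 * (h * (1 - \<delta>))\<bar> = 3 - 2 * h * (1 + \<delta>)"
      by (auto simp: algebra_simps)
    moreover have
      "(\<bar>h * 4 - 3 - 2 * (h * (1 - \<delta>))\<bar> + h * \<delta> * 4)\<^sup>2
        = 4 * (3 / 2 - h * (1 - \<delta>)) * (3 / 2 - h * (1 - \<delta>))"
      unfolding calculation(2) by (simp add: power2_eq_square field_simps)
    ultimately show ?thesis
      using step[of 1 "h * (1 - \<delta>)"] first by (simp add: step_gain_def)
  next
    case middle
    interpret middle_regime h \<delta> "h * (1 + \<delta>) - 1" by (rule middle_regimeI[OF h(1,2) middle])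
    show ?thesis
      using step[OF less_imp_le[OF rate_lambda_pos] gain_certificate] middle
      by (simp add: step_gain_def)
  next
    case last
    define r where "r = h * (1 + \<delta>) - 1"
    define p where "p = (1 / r\<^sup>2 - 1) / 2"
    \<comment> \<open>The multiplier that the middle regime reaches at its right end; it satisfies
      \<open>1 + l = 1 / r\<close>.\<close>
    define l where "l = (1 - r) / r"
    have r: "1 / 2 < r" "r \<le> 1"
      unfolding r_def by (rule last_regime[OF h(1,2) less_imp_le[OF last(2)] h(4)])+
    have hr: "r\<^sup>2 - r + 1 \<le> h * r"
      using breakpoint2_props(3)[OF h(1,2), of h] last(2) r(2) by (simp add: r_def)
    have l: "0 \<le> l" "1 + l = 1 / r" "1 + 2 * l = (2 - r) / r"
      using r by (simp_all add: l_def field_simps)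
    have a: "(1 + 2 * l) / 2 - p * l\<^sup>2 = (2 * r - 1) / (2 * r ^ 4)"
      unfolding l(3) unfolding p_def l_def using r
      by (simp add: field_simps) algebra
    have b: "(1 + 2 * l) / 2 - p = (2 * r - 1) / (2 * r\<^sup>2)"
      unfolding l(3) p_def using r by (simp add: field_simps power2_eq_square)
    have m: "h * (1 + l)\<^sup>2 - (1 + 2 * l) - 2 * p * l = (h * r - (r\<^sup>2 - r + 1)) / r ^ 3"
      unfolding l(2,3) unfolding p_def l_def using r
      by (simp add: field_simps) algebra
    have hd: "h * \<delta> = 1 + r - h" by (simp add: r_def algebra_simps)
    \<comment> \<open>Past the second breakpoint the absolute value opens with a plus sign, and the
      \<open>h * \<delta>\<close> term then cancels \<open>h\<close>. Only \<open>r\<close> remains,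
      and the discriminant condition is again an equality.\<close>
    have "0 \<le> (h * r - (r\<^sup>2 - r + 1)) / r ^ 3" using hr r by simp
    then have "\<bar>h * (1 + l)\<^sup>2 - (1 + 2 * l) - 2 * p * l\<bar> + h * \<delta> * (1 + l)\<^sup>2
        = (h * r - (r\<^sup>2 - r + 1)) / r ^ 3 + (1 + r - h) / r\<^sup>2"
      unfolding m unfolding l(2)
      by (simp only: abs_of_nonneg) (simp add: hd power_divide)
    also have "\<dots> = (2 * r - 1) / r ^ 3"
      using r by (simp add: field_simps power2_eq_square power3_eq_cube)
    finally have eq: "\<bar>h * (1 + l)\<^sup>2 - (1 + 2 * l) - 2 * p * l\<bar> + h * \<delta> * (1 + l)\<^sup>2 = (2 * r - 1) / r ^ 3" .
    have "((2 * r - 1) / r ^ 3)\<^sup>2 = 4 * ((2 * r - 1) / (2 * r ^ 4)) * ((2 * r - 1) / (2 * r\<^sup>2))"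
      using r by (simp add: divide_simps) algebra
    then have disc: "(\<bar>h * (1 + l)\<^sup>2 - (1 + 2 * l) - 2 * p * l\<bar> + h * \<delta> * (1 + l)\<^sup>2)\<^sup>2
        \<le> 4 * ((1 + 2 * l) / 2 - p * l\<^sup>2) * ((1 + 2 * l) / 2 - p)"
      unfolding a b eq by (rule eq_refl)
    have "p * (norm (gradient f (x - (h / L) *\<^sub>R d)))\<^sup>2 / L \<le> f x - f (x - (h / L) *\<^sub>R d)"
      using r by (intro step[OF l(1) _ _ disc]) (simp_all add: a b)
    then show ?thesis using last by (simp add: step_gain_def p_def r_def)
  qed
qed

section \<open>Continuity of the rate\<close>

text \<open>A function into a compact set is continuous if its graph is closed. By
  \<open>rate_lambda_eqI\<close> the graph is cut out by the cubic equation and one non-strict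
  polynomial inequality.\<close>

lemma continuous_on_rate_lambda:
  assumes "0 < \<delta>" "\<delta> < 1"
  shows "continuous_on {breakpoint1 \<delta>..breakpoint2 \<delta>} (\<lambda>h. rate_lambda h \<delta>)"
proof (rule continuous_from_closed_graph)
  let ?S = "{breakpoint1 \<delta>..breakpoint2 \<delta>}"
  have mid: "middle_regime h \<delta> (h * (1 + \<delta>) - 1)" if "h \<in> ?S" for h
    using that assms by (intro middle_regimeI) auto
  show "(\<lambda>h. rate_lambda h \<delta>) \<in> ?S \<rightarrow> {0..1}"
    using middle_regime.rate_lambda_le[OF mid] middle_regime.rate_lambda_pos[OF mid]
    by (force intro: less_imp_le)
  have "(\<lambda>h. (h, rate_lambda h \<delta>)) ` ?S
      = ?S \<times> UNIV \<inter> {z. rate_cubic (fst z) \<delta> (snd z) = 0}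
        \<inter> {z. 1 \<le> (fst z * (1 + \<delta>) - 1) * (1 + snd z)}" (is "_ = ?G")
    using middle_regime.rate_lambda_root[OF mid] middle_regime.rate_lambda_ge[OF mid]
      middle_regime.rate_lambda_eqI[OF mid]
    by auto
  moreover have "closed {z :: real \<times> real. rate_cubic (fst z) \<delta> (snd z) = 0}"
    unfolding rate_cubic_def by (intro closed_Collect_eq continuous_intros)
  moreover have "closed {z :: real \<times> real. 1 \<le> (fst z * (1 + \<delta>) - 1) * (1 + snd z)}"
    by (intro closed_Collect_le continuous_intros)
  moreover have "closed (?S \<times> (UNIV :: real set))" by (intro closed_Times) auto
  ultimately show "closed ((\<lambda>h. (h, rate_lambda h \<delta>)) ` ?S)"
    by (simp only: closed_Int)
qed simp

text \<open>Pasting over three closed intervals. The formulas agree where they meet, as the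
  multiplier is \<open>1\<close> at the first breakpoint and \<open>(1 - r) / r\<close> at the
  second.\<close>

lemma continuous_on_step_gain:
  assumes "0 < \<delta>" "\<delta> < 1"
  shows "continuous_on {0..2 / (1 + \<delta>)} (\<lambda>h. step_gain h \<delta>)"
proof -
  let ?b1 = "breakpoint1 \<delta>" and ?b2 = "breakpoint2 \<delta>"
  note b = breakpoint2_props(1,2)[OF assms]
  have mid: "middle_regime h \<delta> (h * (1 + \<delta>) - 1)" if "h \<in> {?b1..?b2}" for h
    using that assms by (intro middle_regimeI) auto
  have b1: "middle_gain ?b1 \<delta> = ?b1 * (1 - \<delta>)"
  proof -
    have "?b1 = (3 / 2) / (1 + \<delta>)" by (simp add: breakpoint1_def)
    moreover have "1 + \<delta> \<noteq> 0" using assms by simp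
    ultimately have "?b1 * (1 + \<delta>) = 3 / 2" by (metis nonzero_eq_divide_eq)
    then have "rate_lambda ?b1 \<delta> = 1"
      using middle_regime.rate_lambda_lower_end[OF mid[of ?b1]] b by simp
    then show ?thesis
      using assms by (simp add: middle_gain_def breakpoint1_def field_simps)
  qed
  have b2: "middle_gain ?b2 \<delta> = (1 / (?b2 * (1 + \<delta>) - 1)\<^sup>2 - 1) / 2"
  proof -
    define r where "r = ?b2 * (1 + \<delta>) - 1"
    have r: "1 / 2 < r" "r < 1"
      using last_regime(1)[OF assms order_refl] b assms
      by (simp_all add: r_def pos_less_divide_eq)
    have hr: "?b2 * r = r\<^sup>2 - r + 1"
      unfolding r_def by (rule breakpoint2_props(4)[OF assms refl])
    have "rate_lambda ?b2 \<delta> = (1 - r) / r"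
      using middle_regime.rate_lambda_upper_end[OF mid[of ?b2]] b hr by (simp add: r_def)
    moreover have "1 + (1 - r) / r = 1 / r" "1 + 2 * ((1 - r) / r) = (2 - r) / r"
      using r by (simp_all add: field_simps)
    moreover have "?b2 = (r\<^sup>2 - r + 1) / r" using hr r by (simp add: field_simps)
    ultimately have "middle_gain ?b2 \<delta>
        = ((r\<^sup>2 - r + 1) / r * (1 / r)\<^sup>2 - (2 - r) / r) / (2 * ((1 - r) / r))"
      by (simp add: middle_gain_def)
    also have "\<dots> = (1 / r\<^sup>2 - 1) / 2"
      using r by (simp add: field_simps power2_eq_square)
    finally show ?thesis unfolding r_def .
  qed
  have "continuous_on {0..?b1} (\<lambda>h. step_gain h \<delta>)"
  proof (rule continuous_on_eq)
    show "continuous_on {0..?b1} (\<lambda>h. h * (1 - \<delta>))" by (intro continuous_intros)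
    show "h * (1 - \<delta>) = step_gain h \<delta>" if "h \<in> {0..?b1}" for h
      using that b1 b by (cases "h = ?b1") (auto simp: step_gain_def)
  qed
  moreover have "continuous_on {?b1..?b2} (\<lambda>h. step_gain h \<delta>)"
  proof (rule continuous_on_eq)
    show "continuous_on {?b1..?b2} (\<lambda>h. middle_gain h \<delta>)"
      unfolding middle_gain_def
      by (intro continuous_intros continuous_on_rate_lambda assms)
        (use middle_regime.rate_lambda_pos[OF mid] in force)
    show "middle_gain h \<delta> = step_gain h \<delta>" if "h \<in> {?b1..?b2}" for h
      using that by (auto simp: step_gain_def)
  qed
  moreover have "continuous_on {?b2..2 / (1 + \<delta>)} (\<lambda>h. step_gain h \<delta>)"
  proof (rule continuous_on_eq)
    show "continuous_on {?b2..2 / (1 + \<delta>)} (\<lambda>h. (1 / (h * (1 + \<delta>) - 1)\<^sup>2 - 1) / 2)"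
      by (intro continuous_intros) (use last_regime(1)[OF assms] in force)+
    show "(1 / (h * (1 + \<delta>) - 1)\<^sup>2 - 1) / 2 = step_gain h \<delta>" if "h \<in> {?b2..2 / (1 + \<delta>)}" for h
      using that b2 b by (cases "h = ?b2") (auto simp: step_gain_def)
  qed
  ultimately have "continuous_on ({0..?b1} \<union> {?b1..?b2} \<union> {?b2..2 / (1 + \<delta>)}) (\<lambda>h. step_gain h \<delta>)"
    by (intro continuous_on_closed_Un closed_Un) auto
  moreover have "0 \<le> ?b1" using assms by (simp add: breakpoint1_def)
  then have "{0..?b1} \<union> {?b1..?b2} \<union> {?b2..2 / (1 + \<delta>)} = {0..2 / (1 + \<delta>)}"
    using b by auto
  ultimately show ?thesis by simp
qed

text \<open>Nonnegativity of the gain keeps the denominator away from zero.\<close>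

lemma continuous_on_rate_const:
  assumes "0 < \<delta>" "\<delta> < 1"
  shows "continuous_on {0..2 / (1 + \<delta>)} (\<lambda>h. rate_const N h \<delta>)"
proof (rule continuous_on_eq)
  have "real N * step_gain h \<delta> + 1 / 2 \<noteq> 0" if "h \<in> {0..2 / (1 + \<delta>)}" for h
    using step_gain_nonneg[OF assms, of h] that
    by (intro less_imp_neq[symmetric] add_nonneg_pos mult_nonneg_nonneg) auto
  then show "continuous_on {0..2 / (1 + \<delta>)} (\<lambda>h. 1 / (real N * step_gain h \<delta> + 1 / 2))"
    by (intro continuous_intros continuous_on_step_gain assms) auto
  show "1 / (real N * step_gain h \<delta> + 1 / 2) = rate_const N h \<delta>" if "h \<in> {0..2 / (1 + \<delta>)}" for h
    using rate_const_eq[OF assms] that by simp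
qed

theorem theorem3p1:
  fixes f :: "real ^ 'd \<Rightarrow> real" and x :: "nat \<Rightarrow> real ^ 'd" and xstar :: "real ^ 'd"
    and L \<delta> h :: real and N :: nat
  assumes "L > 0"
    and "convex_on UNIV f"
    and "smooth_with L f"
    and "\<forall>y. f xstar \<le> f y"
    and "0 < \<delta>" and "\<delta> < 1"
    and "h \<in> {0..2 / (1 + \<delta>)}"
    and "N \<ge> 1"
    and "inexact_gd_iterates f L h \<delta> N x"
  shows "1 / L * Min ((\<lambda>k. (norm (gradient f (x k)))\<^sup>2) ` {1..N})
           \<le> rate_const N h \<delta> * (f (x 0) - f xstar)
         \<and> continuous_on {0..2 / (1 + \<delta>)} (\<lambda>h'. rate_const N h' \<delta>)"
proof
  have h: "0 \<le> h" "h \<le> 2 / (1 + \<delta>)" using assms(7) by auto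
  obtain d where d: "norm (d k - gradient f (x k)) \<le> \<delta> * norm (gradient f (x k))"
      "x (Suc k) = x k - (h / L) *\<^sub>R d k" if "k < N" for k
    using assms(9) unfolding inexact_gd_iterates_def by blast
  have "step_gain h \<delta> * (norm (gradient f (x (Suc k))))\<^sup>2 / L \<le> f (x k) - f (x (Suc k))"
    if "k < N" for k
    unfolding d(2)[OF that]
    by (rule step_gain_decrease[OF assms(2,3,1) d(1)[OF that] assms(5,6) h])
  then show "1 / L * Min ((\<lambda>k. (norm (gradient f (x k)))\<^sup>2) ` {1..N})
      \<le> rate_const N h \<delta> * (f (x 0) - f xstar)"
    unfolding rate_const_eq[OF assms(5,6) h]
    by (rule inexact_gd_rate[OF assms(3,1,4) step_gain_nonneg[OF assms(5,6) h] assms(8)])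
  show "continuous_on {0..2 / (1 + \<delta>)} (\<lambda>h'. rate_const N h' \<delta>)"
    by (rule continuous_on_rate_const[OF assms(5,6)])
qed

end
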